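(* Let $W:\mathbb{R}^2\to\mathbb{R}$ be a measurable function satisfying $W(q,p)\ge 0$ and $\pi W(q,p)\le 1$ for all $(q,p)$, and $\int_{\mathbb{R}^2} W(q,p)\,dq\,dp=1$. Then for every integer $n\ge 1$, $$S[W]\;\ge\; B_n:=\ln\pi+\int_{\mathbb{R}^2} W(q,p)\sum_{k=1}^n\frac{(-1)^k}{k}\bigl(\pi W(q,p)-1\bigr)^k\,dq\,dp .$$
   Context: $S[W]:=-\int_{\mathbb{R}^2} W(q,p)\ln W(q,p)\,dq\,dp$ is the Shannon differential entropy of $W$ (the "Wigner entropy"), with the convention $0\ln 0=0$. Under the stated hypotheses $0\le W\le 1/\pi<1$, so the integrand $-W\ln W$ is non-negative and $S[W]\in[0,+\infty]$ is well defined. Every Wigner function of a single-mode quantum state that is everywhere non-negative satisfies these hypotheses, but $W$ is not required to be the Wigner function of a quantum state. *)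

theory Defs
  imports "HOL-Analysis.Analysis"
begin

(* Lebesgue integral with values in the extended reals: integral of the positive part minus
   integral of the negative part. The Bochner integral is not suitable for the entropy, because
   it is 0 by convention on non-integrable functions. If both parts are infinite, the value
   below is the meaningless infinity of ereal subtraction. *)
definition ext_integral :: "'a measure \<Rightarrow> ('a \<Rightarrow> real) \<Rightarrow> ereal" where
  "ext_integral M f =
     enn2ereal (\<integral>\<^sup>+ x. ennreal (f x) \<partial>M) - enn2ereal (\<integral>\<^sup>+ x. ennreal (- f x) \<partial>M)"

(* The convention 0 ln 0 = 0 holds automatically, since ln is total. *)
definition wigner_entropy :: "(real \<times> real \<Rightarrow> real) \<Rightarrow> ereal" where
  "wigner_entropy W = - ext_integral lebesgue (\<lambda>(q, p). W (q, p) * ln (W (q, p)))"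

(* A Bochner integral: for W measurable and integrable with 0 \<le> pi W \<le> 1, the sum is bounded,
   so the integrand is integrable. *)
definition wigner_bound :: "nat \<Rightarrow> (real \<times> real \<Rightarrow> real) \<Rightarrow> real" where
  "wigner_bound n W =
     ln pi + (\<integral>(q, p). W (q, p) * (\<Sum>k = 1..n. (- 1) ^ k / real k * (pi * W (q, p) - 1) ^ k) \<partial>lebesgue)"

end

theory Submission
  imports Defs
begin

text \<open>
  With x = pi W, the sum in the bound is a partial sum of the series
  -ln x = (1 - x) + (1 - x)^2 / 2 + ..., all of whose terms are non-negative for 0 < x \<le> 1.
  Hence -W ln W = W (ln pi - ln (pi W)) dominates W times (ln pi + partial sum) pointwise, and
  the latter is integrable because the partial sums are bounded.
\<close>

lemma partial_sum_le_minus_ln: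
  fixes x :: real
  assumes "0 < x" "x \<le> 1"
  shows "(\<Sum>k = 1..n. (- 1) ^ k / real k * (x - 1) ^ k) \<le> - ln x"
proof -
  define a where "a k = (- 1) ^ k / real k * (x - 1) ^ k" for k
  have a_eq: "a k = (1 - x) ^ k / real k" for k
    by (simp add: a_def flip: power_mult_distrib)
  \<comment> \<open>The series starts at k = 0, but \<open>a 0\<close> is a division by zero and
    hence 0, so nothing is added to the sum over \<open>{1..n}\<close>.\<close>
  have "(\<lambda>k. - a k) sums ln x"
    using ln_series'[of "x - 1"] assms by (simp add: a_eq)
  then have "a sums (- ln x)"
    by (auto dest: sums_minus)
  then have "summable a" "suminf a = - ln x"
    by (simp_all add: sums_iff)
  moreover have "0 \<le> a k" for k
    using assms by (simp add: a_eq)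
  ultimately show ?thesis
    using sum_le_suminf[of a "{1..n}"] by (simp add: a_def)
qed

lemma entropy_density_ge:
  fixes w :: real
  assumes "0 \<le> w" "pi * w \<le> 1"
  shows "w * (ln pi + (\<Sum>k = 1..n. (- 1) ^ k / real k * (pi * w - 1) ^ k)) \<le> - (w * ln w)"
\<comment> \<open>The logarithmic series needs \<open>pi * w > 0\<close>; at \<open>w = 0\<close>
  both sides vanish.\<close>
proof (cases "w = 0")
  case False
  with assms have "0 < w" by simp
  then have "ln pi + (\<Sum>k = 1..n. (- 1) ^ k / real k * (pi * w - 1) ^ k) \<le> - ln w"
    using partial_sum_le_minus_ln[of "pi * w" n] assms by (simp add: ln_mult)
  then show ?thesis
    using \<open>0 < w\<close> by (metis mult_left_mono less_imp_le mult_minus_right)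
qed simp

text \<open>The positive part of \<open>f\<close> contributes 0, so no difference of infinities
  arises. This turns the entropy into a non-negative integral, possibly infinite.\<close>

lemma ext_integral_nonpos:
  assumes "\<And>x. f x \<le> 0"
  shows "- ext_integral M f = enn2ereal (\<integral>\<^sup>+ x. ennreal (- f x) \<partial>M)"
  using assms by (simp add: ext_integral_def ennreal_neg zero_ennreal.rep_eq)

theorem mainTheorem1:
  fixes W :: "real \<times> real \<Rightarrow> real" and n :: nat
  assumes "W \<in> borel_measurable lebesgue"
    and "\<And>q p. W (q, p) \<ge> 0"
    and "\<And>q p. pi * W (q, p) \<le> 1"
    and "(\<integral>(q, p). W (q, p) \<partial>lebesgue) = 1"
    and "n \<ge> 1"
  shows "wigner_entropy W \<ge> ereal (wigner_bound n W)"
proof -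
  note [measurable] = assms(1)
  have nonneg: "0 \<le> W z" and le1: "pi * W z \<le> 1" for z
    using assms(2,3) by (cases z, simp)+
  have int1: "(\<integral>z. W z \<partial>lebesgue) = 1"
    using assms(4) by simp
  \<comment> \<open>A non-integrable function would have Bochner integral 0, not 1.\<close>
  then have intW: "integrable lebesgue W"
    using not_integrable_integral_eq by fastforce
  define s where "s z = (\<Sum>k = 1..n. (- 1) ^ k / real k * (pi * W z - 1) ^ k)" for z
  have [measurable]: "s \<in> borel_measurable lebesgue"
    unfolding s_def[abs_def] by measurable
  have s_eq: "s z = (\<Sum>k = 1..n. (1 - pi * W z) ^ k / real k)" for z
    by (simp add: s_def flip: power_mult_distrib)
  have s_nonneg: "0 \<le> s z" for z
    unfolding s_eq using le1 by (intro sum_nonneg) simp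
  \<comment> \<open>Each of the n terms is at most 1; this crude bound lets \<open>n * W\<close>
    dominate \<open>W * s\<close>.\<close>
  have s_le: "s z \<le> real n" for z
  proof -
    have "(1 - pi * W z) ^ k / real k \<le> 1" if "k \<in> {1..n}" for k
    proof -
      have "(1 - pi * W z) ^ k \<le> 1"
        using nonneg[of z] le1[of z] by (intro power_le_one) auto
      also have "1 \<le> real k" using that by simp
      finally show ?thesis using that by simp
    qed
    then show ?thesis
      unfolding s_eq
      using sum_bounded_above[of "{1..n}" "\<lambda>k. (1 - pi * W z) ^ k / real k" 1] by simp
  qed
  have intWs: "integrable lebesgue (\<lambda>z. W z * s z)"
  proof (rule Bochner_Integration.integrable_bound)
    show "integrable lebesgue (\<lambda>z. real n * W z)"
      using intW by simp
    show "AE z in lebesgue. norm (W z * s z) \<le> norm (real n * W z)"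
      using nonneg s_nonneg s_le
      by (intro AE_I2) (simp add: abs_mult mult.commute[of "real n"] mult_left_mono)
  qed measurable
  \<comment> \<open>Since \<open>pi > 1\<close>, the bound \<open>pi * W' \<le> 1\<close> forces
    \<open>W' \<le> 1\<close>.\<close>
  have "ln W' \<le> 0" if "0 < W'" "pi * W' \<le> 1" for W'
  proof -
    have "1 * W' \<le> pi * W'"
      using that pi_gt3 by (intro mult_right_mono) auto
    also have "\<dots> \<le> 1" by (fact that(2))
    finally show ?thesis using that(1) by simp
  qed
  then have nonpos: "W z * ln (W z) \<le> 0" for z
    using nonneg[of z] le1[of z] by (cases "W z = 0") (auto simp: mult_nonneg_nonpos)
  \<comment> \<open>The constant \<open>ln pi\<close> moves under the integral because
    \<open>W\<close> has total mass 1.\<close>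
  have "wigner_bound n W = (\<integral>z. W z * (ln pi + s z) \<partial>lebesgue)"
    using intW intWs int1
    by (simp add: wigner_bound_def s_def[abs_def] case_prod_unfold distrib_left)
  \<comment> \<open>Both sides become integrals of non-negative functions, so the pointwise bound
    suffices for the comparison even when the entropy is infinite.\<close>
  also have "ereal \<dots> = enn2ereal (\<integral>\<^sup>+ z. ennreal (W z * (ln pi + s z)) \<partial>lebesgue)"
  proof -
    have 0: "0 \<le> W z * (ln pi + s z)" for z
      using nonneg s_nonneg pi_gt3 by (intro mult_nonneg_nonneg add_nonneg_nonneg) auto
    have "integrable lebesgue (\<lambda>z. W z * (ln pi + s z))"
      using intW intWs by (simp add: distrib_left)
    then show ?thesis
      using 0 by (subst nn_integral_eq_integral) (auto simp: enn2ereal_ennreal)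
  qed
  also have "\<dots> \<le> enn2ereal (\<integral>\<^sup>+ z. ennreal (- (W z * ln (W z))) \<partial>lebesgue)"
    using nonneg le1 entropy_density_ge
    by (auto simp: s_def simp flip: less_eq_ennreal.rep_eq
        intro!: nn_integral_mono ennreal_leI)
  also have "\<dots> = wigner_entropy W"
    using nonpos by (simp add: wigner_entropy_def ext_integral_nonpos case_prod_unfold)
  finally show ?thesis .
qed

end
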